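(* Let $\mathsf H$ be a quaternionic Hilbert space. A map $\mathcal L:\mathbb H\to\mathfrak B(\mathsf H)$ is a left scalar multiplication of $\mathsf H$ if and only if it is a (unital) real $^*$-algebra homomorphism.
   Context: $\mathbb H$ denotes the quaternions, a real $^*$-algebra with involution $q\mapsto\overline q$ (quaternionic conjugation). A quaternionic Hilbert space $\mathsf H$ is a non-zero right $\mathbb H$-module with an additive $\mathbb H$-valued product satisfying $\langle u|vp+wq\rangle=\langle u|v\rangle p+\langle u|w\rangle q$, $\langle u|v\rangle=\overline{\langle v|u\rangle}$, $\langle u|u\rangle\ge0$, such that $\|u\|=\sqrt{\langle u|u\rangle}$ is a complete norm. $\mathfrak B(\mathsf H)$ is the set of bounded right $\mathbb H$-linear operators $\mathsf H\to\mathsf H$, a real $^*$-algebra with composition as product, adjunction $T\mapsto T^*$ as involution, unity $I$, and real scalar multiplication $(Tr)(u)=T(u)r$. A Hilbert basis of $\mathsf H$ is a subset $N$ of pairwise orthogonal unit vectors with $N^\perp=\{0\}$. A left scalar multiplication of $\mathsf H$ is a map $\mathcal L:\mathbb H\to\mathfrak B(\mathsf H)$ for which there is a Hilbert basis $N$ with $\mathcal L(q)u=\sum_{z\in N}zq\langle z|u\rangle$ for all $q\in\mathbb H$, $u\in\mathsf H$. A unital real $^*$-algebra homomorphism $\mathcal L:\mathbb H\to\mathfrak B(\mathsf H)$, $q\mapsto L_q$, is a map with $L_{p+q}=L_p+L_q$, $L_pL_q=L_{pq}$, $L_ru=ur$, $(L_q)^*=L_{\overline q}$ for all $p,q\in\mathbb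 H$, $r\in\mathbb R$, $u\in\mathsf H$. *)

theory Defs
  imports "HOL-Analysis.Analysis"
begin

section \<open>Quaternions\<close>

datatype quat = Quat (qre: real) (qi: real) (qj: real) (qk: real)

lemma quat_eq_iff: "p = q \<longleftrightarrow> qre p = qre q \<and> qi p = qi q \<and> qj p = qj q \<and> qk p = qk q"
  by (cases p; cases q) simp

instantiation quat :: real_algebra_1
begin

definition "0 = Quat 0 0 0 0"

definition "1 = Quat 1 0 0 0"

definition "p + q = Quat (qre p + qre q) (qi p + qi q) (qj p + qj q) (qk p + qk q)"

definition "- q = Quat (- qre q) (- qi q) (- qj q) (- qk q)"

definition "p - q = Quat (qre p - qre q) (qi p - qi q) (qj p - qj q) (qk p - qk q)"

definition "r *\<^sub>R q = Quat (r * qre q) (r * qi q) (r * qj q) (r * qk q)"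

text \<open>The product given by $i^2 = j^2 = k^2 = ijk = -1$.\<close>

definition "p * q = Quat
  (qre p * qre q - qi p * qi q - qj p * qj q - qk p * qk q)
  (qre p * qi q + qi p * qre q + qj p * qk q - qk p * qj q)
  (qre p * qj q - qi p * qk q + qj p * qre q + qk p * qi q)
  (qre p * qk q + qi p * qj q - qj p * qi q + qk p * qre q)"

instance
  by standard
    (simp_all add: quat_eq_iff zero_quat_def one_quat_def plus_quat_def uminus_quat_def
      minus_quat_def scaleR_quat_def times_quat_def algebra_simps)

end

definition qcnj :: "quat \<Rightarrow> quat"
  where "qcnj q = Quat (qre q) (- qi q) (- qj q) (- qk q)"

lemma quat_sel_simps [simp]:
  "qre 0 = 0" "qi 0 = 0" "qj 0 = 0" "qk 0 = 0"
  "qre 1 = 1" "qi 1 = 0" "qj 1 = 0" "qk 1 = 0"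
  "qre (p + q) = qre p + qre q" "qi (p + q) = qi p + qi q"
  "qj (p + q) = qj p + qj q" "qk (p + q) = qk p + qk q"
  "qre (p - q) = qre p - qre q" "qi (p - q) = qi p - qi q"
  "qj (p - q) = qj p - qj q" "qk (p - q) = qk p - qk q"
  "qre (- q) = - qre q" "qi (- q) = - qi q" "qj (- q) = - qj q" "qk (- q) = - qk q"
  "qre (r *\<^sub>R q) = r * qre q" "qi (r *\<^sub>R q) = r * qi q"
  "qj (r *\<^sub>R q) = r * qj q" "qk (r *\<^sub>R q) = r * qk q"
  "qre (qcnj q) = qre q" "qi (qcnj q) = - qi q" "qj (qcnj q) = - qj q" "qk (qcnj q) = - qk q"
  "qre (of_real r) = r" "qi (of_real r) = 0" "qj (of_real r) = 0" "qk (of_real r) = 0"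
  by (simp_all add: zero_quat_def one_quat_def plus_quat_def minus_quat_def uminus_quat_def
      scaleR_quat_def qcnj_def of_real_def)

lemma quat_mult_sel:
  "qre (p * q) = qre p * qre q - qi p * qi q - qj p * qj q - qk p * qk q"
  "qi (p * q) = qre p * qi q + qi p * qre q + qj p * qk q - qk p * qj q"
  "qj (p * q) = qre p * qj q - qi p * qk q + qj p * qre q + qk p * qi q"
  "qk (p * q) = qre p * qk q + qi p * qj q - qj p * qi q + qk p * qre q"
  by (simp_all add: times_quat_def)


section \<open>Quaternionic Hilbert spaces\<close>

text \<open>
  The real vector space structure and the norm supplied by the superclass \<^class>\<open>banach\<close>
  carry no extra data: \<open>scaleR_qscale\<close> and \<open>norm_qinner\<close> determine
  them, and through the norm the distance and the topology.
\<close>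

class quat_hilbert_space = banach +
  fixes qscale :: "'a \<Rightarrow> quat \<Rightarrow> 'a"  (infixl \<open>\<cdot>\<^sub>q\<close> 75)
    and qinner :: "'a \<Rightarrow> 'a \<Rightarrow> quat"
  assumes nonzero: "\<exists>u. u \<noteq> 0"
    and qscale_add_left: "(u + v) \<cdot>\<^sub>q q = u \<cdot>\<^sub>q q + v \<cdot>\<^sub>q q"
    and qscale_add_right: "u \<cdot>\<^sub>q (p + q) = u \<cdot>\<^sub>q p + u \<cdot>\<^sub>q q"
    and qscale_mult: "u \<cdot>\<^sub>q (p * q) = (u \<cdot>\<^sub>q p) \<cdot>\<^sub>q q"
    and qscale_one: "u \<cdot>\<^sub>q 1 = u"
    and scaleR_qscale: "r *\<^sub>R u = u \<cdot>\<^sub>q of_real r"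
    and qinner_right_linear:
      "qinner u (v \<cdot>\<^sub>q p + w \<cdot>\<^sub>q q) = qinner u v * p + qinner u w * q"
    and qinner_hermitian: "qinner u v = qcnj (qinner v u)"
    and qinner_nonneg: "qinner u u \<in> \<real> \<and> 0 \<le> qre (qinner u u)"
    and norm_qinner: "norm u = sqrt (qre (qinner u u))"

definition qbounded_ops :: "('a::quat_hilbert_space \<Rightarrow> 'a) set"
  where "qbounded_ops =
    {T. bounded_linear T \<and> (\<forall>u q. T (u \<cdot>\<^sub>q q) = T u \<cdot>\<^sub>q q)}"

definition qadj :: "('a::quat_hilbert_space \<Rightarrow> 'a) \<Rightarrow> 'a \<Rightarrow> 'a"
  where "qadj T =
    (THE S. S \<in> qbounded_ops \<and> (\<forall>u v. qinner (S u) v = qinner u (T v)))"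

definition hilbert_basis :: "'a::quat_hilbert_space set \<Rightarrow> bool"
  where "hilbert_basis N \<longleftrightarrow>
    (\<forall>z\<in>N. norm z = 1) \<and>
    (\<forall>z\<in>N. \<forall>w\<in>N. z \<noteq> w \<longrightarrow> qinner z w = 0) \<and>
    {u. \<forall>z\<in>N. qinner z u = 0} = {0}"

text \<open>
  The basis may be uncountable; the sum over it is the unconditional (unordered) sum with
  respect to the norm.
\<close>

definition left_scalar_multiplication :: "(quat \<Rightarrow> 'a::quat_hilbert_space \<Rightarrow> 'a) \<Rightarrow> bool"
  where "left_scalar_multiplication L \<longleftrightarrow>
    (\<exists>N. hilbert_basis N \<and>
      (\<forall>q u. ((\<lambda>z. z \<cdot>\<^sub>q q \<cdot>\<^sub>q qinner z u) has_sum L q u) N))"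

definition real_star_algebra_hom :: "(quat \<Rightarrow> 'a::quat_hilbert_space \<Rightarrow> 'a) \<Rightarrow> bool"
  where "real_star_algebra_hom L \<longleftrightarrow>
    (\<forall>p q u. L (p + q) u = L p u + L q u) \<and>
    (\<forall>p q. L p \<circ> L q = L (p * q)) \<and>
    (\<forall>r u. L (of_real r) u = u \<cdot>\<^sub>q of_real r) \<and>
    (\<forall>q. qadj (L q) = L (qcnj q))"


section \<open>Existence and uniqueness of adjoints\<close>

lemma qinner_add_right: "qinner u (v + w) = qinner u v + qinner u (w::'a::quat_hilbert_space)"
  using qinner_right_linear[of u v 1 w 1] by (simp add: qscale_one)

lemma qscale_zero [simp]: "u \<cdot>\<^sub>q 0 = (0::'a::quat_hilbert_space)"
  using qscale_add_right[of u 0 0] by simp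

lemma qinner_qscale_right: "qinner u (v \<cdot>\<^sub>q q) = qinner u (v::'a::quat_hilbert_space) * q"
  using qinner_right_linear[of u v q v 0] by simp

lemma qcnj_mult: "qcnj (p * q) = qcnj q * qcnj p"
  by (simp add: quat_eq_iff quat_mult_sel algebra_simps)

lemma qcnj_add: "qcnj (p + q) = qcnj p + qcnj q"
  by (simp add: quat_eq_iff)

lemma qinner_add_left: "qinner (u + v) w = qinner u w + qinner v (w::'a::quat_hilbert_space)"
  by (metis qinner_add_right qinner_hermitian qcnj_add)

lemma qinner_qscale_left: "qinner (u \<cdot>\<^sub>q q) v = qcnj q * qinner u (v::'a::quat_hilbert_space)"
  by (metis qinner_qscale_right qinner_hermitian qcnj_mult)

lemma quat_eqI_mult: "(\<And>x. qre (p * x) = qre (q * x)) \<Longrightarrow> p = q"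
proof -
  assume h: "\<And>x. qre (p * x) = qre (q * x)"
  from h[of "Quat 1 0 0 0"] h[of "Quat 0 1 0 0"] h[of "Quat 0 0 1 0"] h[of "Quat 0 0 0 1"]
  show ?thesis by (simp add: quat_eq_iff quat_mult_sel)
qed

definition rinner :: "'a::quat_hilbert_space \<Rightarrow> 'a \<Rightarrow> real"
  where "rinner u v = qre (qinner u v)"

lemma rinner_add_right: "rinner u (v + w) = rinner u v + rinner u w"
  by (simp add: rinner_def qinner_add_right)

lemma rinner_add_left: "rinner (v + w) u = rinner v u + rinner w u"
  by (simp add: rinner_def qinner_add_left)

lemma rinner_commute: "rinner u v = rinner v u"
  unfolding rinner_def by (subst qinner_hermitian) simp

lemma rinner_scaleR_right: "rinner u (r *\<^sub>R v) = r * rinner u v"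
  by (simp add: rinner_def scaleR_qscale qinner_qscale_right quat_mult_sel)

lemma rinner_scaleR_left: "rinner (r *\<^sub>R v) u = r * rinner v u"
  by (metis rinner_commute rinner_scaleR_right)

lemma rinner_diff_right: "rinner u (v - w) = rinner u v - rinner u w"
  using rinner_add_right[of u "v - w" w] by simp

lemma rinner_diff_left: "rinner (v - w) u = rinner v u - rinner w u"
  by (metis rinner_commute rinner_diff_right)

lemma rinner_self: "rinner u u = (norm u)\<^sup>2"
  using qinner_nonneg[of u] by (simp add: rinner_def norm_qinner)

lemmas rinner_simps = rinner_add_left rinner_add_right rinner_diff_left rinner_diff_right
  rinner_scaleR_left rinner_scaleR_right

lemma quadratic_nonneg_imp_linear_zero:
  fixes a b :: real
  assumes "\<And>t. 0 \<le> 2 * t * a + t\<^sup>2 * b"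
  shows "a = 0"
proof (rule ccontr)
  assume a: "a \<noteq> 0"
  define s where "s = a / (\<bar>b\<bar> + 1)"
  have as: "a = s * (\<bar>b\<bar> + 1)" and s: "s \<noteq> 0" using a by (simp_all add: s_def)
  have "0 < s\<^sup>2 * (2 * (\<bar>b\<bar> + 1) - b)" using s by (intro mult_pos_pos) auto
  also have "\<dots> = - (2 * (- s) * a + (- s)\<^sup>2 * b)"
    by (simp add: as power2_eq_square algebra_simps)
  finally show False using assms[of "- s"] by linarith
qed

lemma riesz_real:
  fixes f :: "'a::quat_hilbert_space \<Rightarrow> real"
  assumes "bounded_linear f"
  shows "\<exists>x. \<forall>v. rinner x v = f v"
proof -
  interpret f: bounded_linear f by fact
  obtain K where K: "\<And>x. \<bar>f x\<bar> \<le> norm x * K" using f.bounded by auto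
  define J where "J x = rinner x x - 2 * f x" for x
  have lb: "- K\<^sup>2 \<le> J x" for x
  proof -
    have "0 \<le> (norm x - K)\<^sup>2" by simp
    with K[of x] show ?thesis by (simp add: J_def rinner_self power2_eq_square algebra_simps)
  qed
  define m where "m = Inf (range J)"
  have bdd: "bdd_below (range J)" using lb by (auto intro!: bdd_belowI)
  have mle: "m \<le> J x" for x unfolding m_def using bdd by (intro cInf_lower) auto
  have "\<exists>x. J x < m + 1 / real (Suc n)" for n
    using cInf_lessD[of "range J" "m + 1 / real (Suc n)"] by (auto simp: m_def)
  then obtain X where X: "\<And>n. J (X n) < m + 1 / real (Suc n)" by metis
  have par: "(norm (x - y))\<^sup>2 \<le> 2 * (J x - m) + 2 * (J y - m)" for x y
  proof -
    have "(norm (x - y))\<^sup>2 = 2 * J x + 2 * J y - 4 * J ((1/2) *\<^sub>R (x + y))"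
      using rinner_commute[of x y]
      by (simp only: rinner_self[symmetric] J_def rinner_simps f.add f.scaleR)
        (simp add: algebra_simps)
    with mle[of "(1/2) *\<^sub>R (x + y)"] show ?thesis by simp
  qed
  have "Cauchy X"
  proof (rule metric_CauchyI)
    fix e :: real assume e: "e > 0"
    then obtain M where M: "1 / real (Suc M) < e\<^sup>2 / 4"
      using nat_approx_posE[of "e\<^sup>2 / 4"] by auto
    have b: "J (X n) - m < e\<^sup>2 / 4" if "n \<ge> M" for n
    proof -
      have "1 / real (Suc n) \<le> 1 / real (Suc M)" using that by (simp add: frac_le)
      with X[of n] M show ?thesis by linarith
    qed
    show "\<exists>M. \<forall>i\<ge>M. \<forall>j\<ge>M. dist (X i) (X j) < e"
    proof (intro exI allI impI)
      fix i j assume ij: "M \<le> i" "M \<le> j"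
      have "(norm (X i - X j))\<^sup>2 < e\<^sup>2"
        using le_less_trans[OF par[of "X i" "X j"]] b[OF ij(1)] b[OF ij(2)]
        by (simp add: field_simps)
      then show "dist (X i) (X j) < e"
        using e by (simp add: dist_norm power_less_imp_less_base)
    qed
  qed
  then obtain x where x: "X \<longlonglongrightarrow> x" using Cauchy_convergent convergent_def by blast
  have "(\<lambda>n. J (X n)) \<longlonglongrightarrow> J x"
    unfolding J_def rinner_self by (intro tendsto_intros x f.tendsto)
  moreover have "(\<lambda>n. m + 1 / real (Suc n)) \<longlonglongrightarrow> m + 0"
    by (intro tendsto_intros LIMSEQ_Suc lim_1_over_n)
  ultimately have "J x \<le> m + 0"
    using X by (intro LIMSEQ_le[of "\<lambda>n. J (X n)" _ "\<lambda>n. m + 1 / real (Suc n)"])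
      (auto intro: less_imp_le)
  then have min: "J x \<le> J y" for y using mle[of y] by simp
  have "rinner x v = f v" for v
  proof -
    have "0 \<le> 2 * t * (rinner x v - f v) + t\<^sup>2 * rinner v v" for t
      using min[of "x + t *\<^sub>R v"] rinner_commute[of x v]
      by (simp add: J_def rinner_simps f.add f.scaleR power2_eq_square algebra_simps)
    then have "rinner x v - f v = 0" by (rule quadratic_nonneg_imp_linear_zero)
    then show ?thesis by simp
  qed
  then show ?thesis by blast
qed

lemma rinner_le: "\<bar>rinner u v\<bar> \<le> norm u * norm v"
proof -
  have *: "rinner u v \<le> norm u * norm v" for u v :: 'a
  proof -
    have "2 * rinner u v = (norm (u + v))\<^sup>2 - (norm u)\<^sup>2 - (norm v)\<^sup>2"
      using rinner_commute[of u v] by (simp add: rinner_self[symmetric] rinner_simps)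
    also have "(norm (u + v))\<^sup>2 \<le> (norm u + norm v)\<^sup>2"
      by (intro power_mono norm_triangle_ineq) simp
    finally show ?thesis by (simp add: power2_sum)
  qed
  have "- rinner u v \<le> norm u * norm v"
    using *[of "- u" v] rinner_scaleR_left[of "- 1" u v] by simp
  with *[of u v] show ?thesis by (simp add: abs_le_iff)
qed

lemma qinner_bounded_linear:
  assumes "T \<in> qbounded_ops"
  shows "bounded_linear (\<lambda>v. rinner u (T v))"
proof -
  interpret T: bounded_linear T using assms by (simp add: qbounded_ops_def)
  have "bounded_linear (rinner u)"
    by (rule bounded_linear_intro[where K = "norm u"])
      (use rinner_le[of u] in \<open>auto simp: rinner_simps mult.commute\<close>)
  then show ?thesis by (rule bounded_linear_compose) (rule T.bounded_linear_axioms)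
qed

lemma qinner_ext:
  assumes "\<And>v. qinner u v = qinner w v"
  shows "u = w"
proof -
  have "rinner u v = rinner w v" for v
    unfolding rinner_def assms ..
  then have "rinner (u - w) (u - w) = 0" unfolding rinner_diff_left by simp
  then show ?thesis by (simp add: rinner_self)
qed

theorem qadj_ex1:
  fixes T :: "'a::quat_hilbert_space \<Rightarrow> 'a"
  assumes T: "T \<in> qbounded_ops"
  shows "\<exists>!S. S \<in> qbounded_ops \<and> (\<forall>u v. qinner (S u) v = qinner u (T v))"
proof -
  interpret T: bounded_linear T using T by (simp add: qbounded_ops_def)
  have Tq: "T (u \<cdot>\<^sub>q q) = T u \<cdot>\<^sub>q q" for u q using T by (simp add: qbounded_ops_def)
  have "\<exists>x. \<forall>v. rinner x v = rinner u (T v)" for u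
    by (rule riesz_real) (rule qinner_bounded_linear[OF T])
  then obtain S where S: "\<And>u v. rinner (S u) v = rinner u (T v)" by metis
  have adj: "qinner (S u) v = qinner u (T v)" for u v
  proof (rule quat_eqI_mult)
    fix x
    show "qre (qinner (S u) v * x) = qre (qinner u (T v) * x)"
      using S[of u "v \<cdot>\<^sub>q x"] unfolding rinner_def Tq qinner_qscale_right .
  qed
  have Sadd: "S (u + w) = S u + S w" for u w
    by (rule qinner_ext) (simp add: adj qinner_add_left)
  have Sq: "S (u \<cdot>\<^sub>q q) = S u \<cdot>\<^sub>q q" for u q
    by (rule qinner_ext) (simp add: adj qinner_qscale_left)
  obtain K where K: "K > 0" "\<And>x. norm (T x) \<le> norm x * K" using T.pos_bounded by auto
  have Sbd: "norm (S u) \<le> norm u * K" for u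
  proof (cases "S u = 0")
    case False
    have "norm (S u) * norm (S u) = rinner u (T (S u))"
      using S[of u "S u"] by (simp add: rinner_self power2_eq_square)
    also have "\<dots> \<le> norm u * norm (T (S u))" using rinner_le[of u "T (S u)"] by linarith
    also have "\<dots> \<le> norm u * (norm (S u) * K)" by (intro mult_left_mono K) simp
    finally have "norm (S u) * norm (S u) \<le> norm (S u) * (norm u * K)" by (simp add: ac_simps)
    with False show ?thesis by simp
  qed (use K in simp)
  have "bounded_linear S"
    by (rule bounded_linear_intro[where K = K]) (auto simp: Sadd Sq Sbd scaleR_qscale)
  with Sq have "S \<in> qbounded_ops" by (simp add: qbounded_ops_def)
  moreover have "S' = S" if "\<forall>u v. qinner (S' u) v = qinner u (T v)" for S'
    by (intro ext qinner_ext) (simp add: that adj)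
  ultimately show ?thesis using adj by blast
qed

lemma qadj_works:
  assumes "T \<in> qbounded_ops"
  shows "qadj T \<in> qbounded_ops" "qinner (qadj T u) v = qinner u (T v)"
  using theI'[OF qadj_ex1[OF assms]] unfolding qadj_def[symmetric] by auto

end

theory Submission
  imports Defs
begin

text \<open>
  A left scalar multiplication satisfies \<open>L q z = z \<cdot>\<^sub>q q\<close> on the basis, so every identity
  required of a homomorphism can be checked termwise in the orthonormal expansion. Conversely,
  a homomorphism \<open>L\<close> acts as wanted on the real subspace \<open>F = {u. \<forall>q. L q u = u \<cdot>\<^sub>q q}\<close>.
  The element \<open>v - L i v i - L j v j - L k v k\<close> always lies in \<open>F\<close>, and \<open>4 v\<close> is a right
  quaternionic combination of such elements for \<open>v\<close>, \<open>v i\<close>, \<open>v j\<close>, \<open>v k\<close>. Since this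
  averaging respects orthogonality to vectors of \<open>F\<close>, a maximal orthonormal subset of \<open>F\<close>
  is already a Hilbert basis of the whole space.
\<close>

section \<open>Orthogonal series\<close>

lemma bounded_linear_rinner_right: "bounded_linear (rinner u)"
  by (rule bounded_linear_intro[where K = "norm u"])
    (use rinner_le[of u] in \<open>auto simp: rinner_simps mult.commute\<close>)

lemma bounded_linear_rinner_left: "bounded_linear (\<lambda>v. rinner v u)"
proof -
  have "(\<lambda>v. rinner v u) = rinner u" by (intro ext rinner_commute)
  then show ?thesis by (simp add: bounded_linear_rinner_right)
qed

lemmas rinner_sum_right = linear_sum[OF bounded_linear.linear[OF bounded_linear_rinner_right]]
lemmas rinner_sum_left = linear_sum[OF bounded_linear.linear[OF bounded_linear_rinner_left]]

lemma rinner_zero [simp]: "rinner u 0 = 0" "rinner 0 u = 0"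
  using linear_0[OF bounded_linear.linear[OF bounded_linear_rinner_right]]
    linear_0[OF bounded_linear.linear[OF bounded_linear_rinner_left]] by auto

lemma norm_sum_orthogonal:
  assumes "finite F" and "\<And>x y. x \<in> F \<Longrightarrow> y \<in> F \<Longrightarrow> x \<noteq> y \<Longrightarrow> rinner (f x) (f y) = 0"
  shows "(norm (sum f F))\<^sup>2 = (\<Sum>x\<in>F. (norm (f x))\<^sup>2)"
  using assms
proof (induction F rule: finite_induct)
  case (insert x F)
  have "rinner (f x) (sum f F) = 0"
    unfolding rinner_sum_right using insert by (intro sum.neutral) auto
  then have "(norm (f x + sum f F))\<^sup>2 = (norm (f x))\<^sup>2 + (norm (sum f F))\<^sup>2"
    using rinner_commute[of "f x" "sum f F"] by (simp add: rinner_self[symmetric] rinner_simps)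
  then show ?case using insert by simp
qed simp

text \<open>The finite sums of squared norms have a supremum \<open>S\<close>. Once
  \<open>F0\<close> comes within \<open>(e/2)\<^sup>2\<close> of it, Pythagoras keeps the partial
  sum of \<open>f\<close> over any larger finite set within \<open>e/2\<close> of the one over
  \<open>F0\<close>. So the net of partial sums is Cauchy, whatever the cardinality of
  \<open>A\<close>.\<close>

lemma summable_on_orthogonal:
  fixes f :: "'b \<Rightarrow> 'a::quat_hilbert_space"
  assumes orth: "\<And>x y. x \<in> A \<Longrightarrow> y \<in> A \<Longrightarrow> x \<noteq> y \<Longrightarrow> rinner (f x) (f y) = 0"
    and bound: "\<And>F. finite F \<Longrightarrow> F \<subseteq> A \<Longrightarrow> (\<Sum>x\<in>F. (norm (f x))\<^sup>2) \<le> B"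
  shows "f summable_on A"
proof -
  define g where "g x = (norm (f x))\<^sup>2" for x
  define \<F> where "\<F> = {F. finite F \<and> F \<subseteq> A}"
  define S where "S = Sup (sum g ` \<F>)"
  have bdd: "bdd_above (sum g ` \<F>)"
    using bound by (auto simp: \<F>_def g_def intro!: bdd_aboveI)
  have ne: "sum g ` \<F> \<noteq> {}" by (auto simp: \<F>_def)
  have le: "sum g F \<le> S" if "F \<in> \<F>" for F
    unfolding S_def using that bdd by (intro cSup_upper) auto
  have "\<exists>P. eventually P (finite_subsets_at_top A) \<and>
      (\<forall>F G. P F \<and> P G \<longrightarrow> dist (sum f F) (sum f G) < e)" if e: "e > 0" for e
  proof -
    have "S - (e/2)\<^sup>2 < S" using e by simp
    then obtain F0 where F0: "F0 \<in> \<F>" "S - (e/2)\<^sup>2 < sum g F0"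
      unfolding S_def using less_cSup_iff[OF ne bdd] by auto
    define P where "P F \<longleftrightarrow> finite F \<and> F0 \<subseteq> F \<and> F \<subseteq> A" for F
    have near: "dist (sum f F) (sum f F0) < e/2" if "P F" for F
    proof -
      have fin: "finite F" "F0 \<subseteq> F" "F \<subseteq> A" using that by (auto simp: P_def)
      have "(dist (sum f F) (sum f F0))\<^sup>2 = (norm (sum f (F - F0)))\<^sup>2"
        using fin by (simp add: dist_norm sum_diff)
      also have "\<dots> = sum g (F - F0)"
        unfolding g_def by (rule norm_sum_orthogonal) (use fin in \<open>auto intro!: orth\<close>)
      also have "\<dots> = sum g F - sum g F0"
        using fin by (simp add: sum_diff)
      also have "\<dots> < (e/2)\<^sup>2" using le[of F] F0(2) fin by (simp add: \<F>_def)
      finally show ?thesis using e by (intro power_less_imp_less_base[of _ 2 "e/2"]) auto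
    qed
    have "dist (sum f F) (sum f G) < e" if "P F" "P G" for F G
      using near[OF that(1)] near[OF that(2)] dist_triangle2[of "sum f F" "sum f G" "sum f F0"]
      by linarith
    moreover have "eventually P (finite_subsets_at_top A)"
      unfolding eventually_finite_subsets_at_top P_def using F0(1) by (auto simp: \<F>_def)
    ultimately show ?thesis by blast
  qed
  then have "cauchy_filter (filtermap (sum f) (finite_subsets_at_top A))"
    by (simp add: cauchy_filter_metric_filtermap)
  moreover have "complete (UNIV::'a set)"
    by (meson Cauchy_convergent UNIV_I complete_def convergent_def)
  ultimately obtain s where "(sum f \<longlongrightarrow> s) (finite_subsets_at_top A)"
    using complete_uniform[where S = UNIV] by (force simp add: filterlim_def)
  then show ?thesis by (auto simp: summable_on_def has_sum_def)
qed

section \<open>Expansion in a Hilbert basis\<close>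

lemma qcnj_simps [simp]: "qcnj (qcnj q) = q" "qcnj 0 = 0" "qcnj q = 0 \<longleftrightarrow> q = 0"
  by (auto simp: quat_eq_iff)

lemma qinner_zero [simp]: "qinner u 0 = 0" "qinner 0 u = (0::quat)"
proof -
  show "qinner u 0 = 0" for u :: 'a
    using qinner_qscale_right[of u 0 0] by simp
  then show "qinner 0 u = 0" by (subst qinner_hermitian) simp
qed

lemma qinner_eq_0_commute: "qinner u v = 0 \<longleftrightarrow> qinner v u = (0::quat)"
  by (subst qinner_hermitian) simp

lemma qscale_0_left [simp]: "0 \<cdot>\<^sub>q q = (0::'a::quat_hilbert_space)"
  using qscale_add_left[of 0 0 q] by simp

lemma qscale_minus_left: "(- u) \<cdot>\<^sub>q q = - (u \<cdot>\<^sub>q q)"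
  using qscale_add_left[of "- u" u q] by (simp add: eq_neg_iff_add_eq_0)

lemma qscale_minus_right: "u \<cdot>\<^sub>q (- q) = - (u \<cdot>\<^sub>q q)"
  using qscale_add_right[of u "- q" q] by (simp add: eq_neg_iff_add_eq_0)

lemma qscale_diff_left: "(u - v) \<cdot>\<^sub>q q = u \<cdot>\<^sub>q q - v \<cdot>\<^sub>q q"
  using qscale_add_left[of u "- v" q] by (simp add: qscale_minus_left)

lemma qinner_diff_right: "qinner u (v - w) = qinner u v - qinner u w"
  using qinner_add_right[of u "v - w" w] by simp

text \<open>The norm determines only the real part; by \<open>qinner_nonneg\<close> the other
  coordinates vanish.\<close>

lemma qinner_unit: "norm z = 1 \<Longrightarrow> qinner z z = 1"
  using qinner_nonneg[of z] rinner_self[of z] by (auto simp: rinner_def Reals_def)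

text \<open>Bessel's inequality bounds the squared norms of the orthogonal terms, so the series has
  some sum \<open>s\<close>. Then \<open>s - u\<close> is orthogonal to all of \<open>N\<close>,
  hence zero.\<close>

lemma hilbert_basis_expansion:
  fixes u :: "'a::quat_hilbert_space"
  assumes N: "hilbert_basis N"
  shows "((\<lambda>z. z \<cdot>\<^sub>q qinner z u) has_sum u) N"
proof -
  define f where "f z = z \<cdot>\<^sub>q qinner z u" for z
  have unit: "qinner z z = 1" if "z \<in> N" for z
    using N that by (simp add: hilbert_basis_def qinner_unit)
  have orth: "qinner z w = 0" if "z \<in> N" "w \<in> N" "z \<noteq> w" for z w
    using N that by (auto simp: hilbert_basis_def)
  have forth: "rinner (f x) (f y) = 0" if "x \<in> N" "y \<in> N" "x \<noteq> y" for x y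
    using orth[OF that] by (simp add: f_def rinner_def qinner_qscale_left qinner_qscale_right)
  have fu: "rinner (f x) u = (norm (f x))\<^sup>2" if "x \<in> N" for x
    using unit[OF that]
    by (simp add: rinner_self[symmetric] f_def rinner_def qinner_qscale_left qinner_qscale_right)
  have bessel: "(\<Sum>x\<in>F. (norm (f x))\<^sup>2) \<le> (norm u)\<^sup>2" if F: "finite F" "F \<subseteq> N" for F
  proof -
    have "(norm (sum f F))\<^sup>2 = (\<Sum>x\<in>F. (norm (f x))\<^sup>2)"
      using F forth by (intro norm_sum_orthogonal) auto
    moreover have "rinner (sum f F) u = (\<Sum>x\<in>F. (norm (f x))\<^sup>2)"
      unfolding rinner_sum_left using F fu by (intro sum.cong) auto
    moreover have "0 \<le> (norm (u - sum f F))\<^sup>2" by simp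
    then have "0 \<le> (norm u)\<^sup>2 - 2 * rinner (sum f F) u + (norm (sum f F))\<^sup>2"
      using rinner_commute[of u "sum f F"]
      by (simp add: rinner_self[symmetric] rinner_simps)
    ultimately show ?thesis by linarith
  qed
  from summable_on_orthogonal[OF forth bessel] obtain s where s: "(f has_sum s) N"
    by (auto simp: summable_on_def)
  have "qinner z s = qinner z u" if z: "z \<in> N" for z
  proof -
    \<comment> \<open>Real parts suffice: letting \<open>q\<close> run through the four units reads
      off every coordinate of \<open>qinner z s\<close>.\<close>
    have "rinner (z \<cdot>\<^sub>q q) s = rinner (z \<cdot>\<^sub>q q) u" for q
    proof -
      have "((\<lambda>x. rinner (z \<cdot>\<^sub>q q) (f x)) has_sum rinner (z \<cdot>\<^sub>q q) s) N"
        by (rule has_sum_bounded_linear[OF bounded_linear_rinner_right s])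
      moreover have "((\<lambda>x. rinner (z \<cdot>\<^sub>q q) (f x)) has_sum rinner (z \<cdot>\<^sub>q q) u) N"
        using z orth[OF z] unit[OF z]
        by (intro has_sum_finite_neutralI[where B = "{z}"])
          (auto simp: f_def rinner_def qinner_qscale_left qinner_qscale_right)
      ultimately show ?thesis by (rule has_sum_unique)
    qed
    then have "qre (qcnj q * qinner z s) = qre (qcnj q * qinner z u)" for q
      by (simp add: rinner_def qinner_qscale_left)
    from this[of "Quat 1 0 0 0"] this[of "Quat 0 1 0 0"] this[of "Quat 0 0 1 0"]
      this[of "Quat 0 0 0 1"]
    show ?thesis by (simp add: quat_eq_iff quat_mult_sel)
  qed
  then have "s - u \<in> {u. \<forall>z\<in>N. qinner z u = 0}" by (simp add: qinner_diff_right)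
  also have "\<dots> = {0}" using N by (simp add: hilbert_basis_def)
  finally show ?thesis using s by (simp add: f_def[abs_def])
qed

section \<open>The two implications\<close>

lemma qadj_eqI:
  assumes T: "T \<in> qbounded_ops" and S: "\<And>u v. qinner (S u) v = qinner u (T v)"
  shows "qadj T = S"
  by (intro ext qinner_ext) (simp add: qadj_works(2)[OF T] S)

lemma left_scalar_multiplication_imp_hom:
  fixes L :: "quat \<Rightarrow> 'a::quat_hilbert_space \<Rightarrow> 'a"
  assumes L: "\<And>q. L q \<in> qbounded_ops" and lsm: "left_scalar_multiplication L"
  shows "real_star_algebra_hom L"
proof -
  from lsm obtain N where N: "hilbert_basis N"
    and sums: "\<And>q u. ((\<lambda>z. z \<cdot>\<^sub>q q \<cdot>\<^sub>q qinner z u) has_sum L q u) N"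
    unfolding left_scalar_multiplication_def by blast
  have bl: "bounded_linear (L q)" and Lq: "L q (u \<cdot>\<^sub>q p) = L q u \<cdot>\<^sub>q p" for p q u
    using L[of q] by (auto simp: qbounded_ops_def)
  \<comment> \<open>Orthogonality leaves only the term \<open>w = z\<close> of the series for
    \<open>L q z\<close>.\<close>
  have basis: "L q z = z \<cdot>\<^sub>q q" if z: "z \<in> N" for q z
  proof -
    have "qinner z z = 1" using N z by (simp add: hilbert_basis_def qinner_unit)
    moreover have "qinner w z = 0" if "w \<in> N" "w \<noteq> z" for w
      using N z that by (auto simp: hilbert_basis_def)
    ultimately have "((\<lambda>w. w \<cdot>\<^sub>q q \<cdot>\<^sub>q qinner w z) has_sum z \<cdot>\<^sub>q q) N"
      using z by (intro has_sum_finite_neutralI[where B = "{z}"]) (auto simp: qscale_one)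
    with sums show ?thesis by (rule has_sum_unique)
  qed
  have add: "L (p + q) u = L p u + L q u" for p q u
    using has_sum_add[OF sums[of p u] sums[of q u]] sums[of "p + q" u]
    by (auto simp: qscale_add_left qscale_add_right intro: has_sum_unique)
  have mult: "L p (L q u) = L (p * q) u" for p q u
  proof -
    have "((\<lambda>z. L p (z \<cdot>\<^sub>q q \<cdot>\<^sub>q qinner z u)) has_sum L p (L q u)) N"
      by (rule has_sum_bounded_linear[OF bl sums])
    also have "?this \<longleftrightarrow> ((\<lambda>z. z \<cdot>\<^sub>q (p * q) \<cdot>\<^sub>q qinner z u) has_sum L p (L q u)) N"
      by (intro has_sum_cong) (simp add: Lq basis qscale_mult)
    finally show ?thesis using sums by (rule has_sum_unique)
  qed
  \<comment> \<open>Reals are central, so \<open>r\<close> times the expansion of \<open>u\<close>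
    is termwise the series of \<open>L (of_real r) u\<close>.\<close>
  have real: "L (of_real r) u = u \<cdot>\<^sub>q of_real r" for r u
  proof -
    have "((\<lambda>z. r *\<^sub>R (z \<cdot>\<^sub>q qinner z u)) has_sum r *\<^sub>R u) N"
      by (rule has_sum_bounded_linear[OF bounded_linear_scaleR_right hilbert_basis_expansion[OF N]])
    also have "(\<lambda>z. r *\<^sub>R (z \<cdot>\<^sub>q qinner z u)) = (\<lambda>z. z \<cdot>\<^sub>q of_real r \<cdot>\<^sub>q qinner z u)"
      by (simp add: scaleR_qscale qscale_mult[symmetric] of_real_def)
    finally show ?thesis using sums has_sum_unique unfolding scaleR_qscale by blast
  qed
  \<comment> \<open>Both sides expand over \<open>N\<close> with terms the real part of
    \<open>qinner u z * q * qinner z v\<close>.\<close>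
  have radj: "rinner (L (qcnj q) u) v = rinner u (L q v)" for q u v
  proof -
    have "((\<lambda>z. rinner (z \<cdot>\<^sub>q qcnj q \<cdot>\<^sub>q qinner z u) v) has_sum rinner (L (qcnj q) u) v) N"
      by (rule has_sum_bounded_linear[OF bounded_linear_rinner_left sums])
    moreover have "((\<lambda>z. rinner u (z \<cdot>\<^sub>q q \<cdot>\<^sub>q qinner z v)) has_sum rinner u (L q v)) N"
      by (rule has_sum_bounded_linear[OF bounded_linear_rinner_right sums])
    moreover have "rinner (z \<cdot>\<^sub>q qcnj q \<cdot>\<^sub>q qinner z u) v = rinner u (z \<cdot>\<^sub>q q \<cdot>\<^sub>q qinner z v)" for z
      by (simp add: rinner_def qinner_qscale_left qinner_qscale_right
          qinner_hermitian[of u z] mult.assoc)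
    ultimately show ?thesis by (simp add: has_sum_unique)
  qed
  \<comment> \<open>Putting \<open>v \<cdot>\<^sub>q x\<close> for \<open>v\<close> in
    \<open>radj\<close> recovers the full quaternion from real parts.\<close>
  have "qinner (L (qcnj q) u) v = qinner u (L q v)" for q u v
  proof (rule quat_eqI_mult)
    fix x
    show "qre (qinner (L (qcnj q) u) v * x) = qre (qinner u (L q v) * x)"
      using radj[of q u "v \<cdot>\<^sub>q x"] by (simp add: rinner_def Lq qinner_qscale_right)
  qed
  then have "qadj (L q) = L (qcnj q)" for q
    by (intro qadj_eqI L)
  with add mult real show ?thesis
    by (auto simp: real_star_algebra_hom_def)
qed

lemma hom_imp_left_scalar_multiplication:
  fixes L :: "quat \<Rightarrow> 'a::quat_hilbert_space \<Rightarrow> 'a"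
  assumes L: "\<And>q. L q \<in> qbounded_ops" and hom: "real_star_algebra_hom L"
  shows "left_scalar_multiplication L"
proof -
  have bl: "bounded_linear (L q)" and Lq: "L q (u \<cdot>\<^sub>q p) = L q u \<cdot>\<^sub>q p" for p q u
    using L[of q] by (auto simp: qbounded_ops_def)
  have Ldiff: "L q (u - v) = L q u - L q v" for q u v
    using linear_diff bounded_linear.linear[OF bl] by blast
  have add: "L (p + q) u = L p u + L q u"
    and mult: "L p (L q u) = L (p * q) u"
    and real: "L (of_real r) u = u \<cdot>\<^sub>q of_real r"
    and adj: "qadj (L q) = L (qcnj q)" for p q r u
    using hom by (auto simp: real_star_algebra_hom_def fun_eq_iff)
  have qadj: "qinner (L (qcnj q) u) v = qinner u (L q v)" for q u v
    using qadj_works(2)[OF L, of q u v] by (simp add: adj)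
  define i j k where "i = Quat 0 1 0 0" and "j = Quat 0 0 1 0" and "k = Quat 0 0 0 1"
  note ijk = i_def j_def k_def
  have table: "i * i = -1" "j * j = -1" "k * k = -1" "i * j = k" "j * k = i" "k * i = j"
    "j * i = - k" "k * j = - i" "i * k = - j"
    by (simp_all add: ijk quat_eq_iff quat_mult_sel)
  have Lneg: "L (- q) u = - L q u" for q u
    using mult[of "of_real (-1)" q u] real[of "-1" "L q u"]
    by (simp add: scaleR_qscale[symmetric] qscale_minus_right qscale_one)
  have L1: "L 1 u = u" for u using real[of 1 u] by (simp add: qscale_one)
  define F where "F = {u. \<forall>q. L q u = u \<cdot>\<^sub>q q}"
  \<comment> \<open>The units \<open>i\<close> and \<open>j\<close> generate the quaternions as a
    real algebra, and \<open>L\<close> is multiplicative and additive.\<close>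
  have FI: "u \<in> F" if u: "L i u = u \<cdot>\<^sub>q i" "L j u = u \<cdot>\<^sub>q j" for u
  proof -
    have "L q u = u \<cdot>\<^sub>q q" for q
    proof -
      have k: "L k u = u \<cdot>\<^sub>q k"
        using mult[of i j u] u by (simp add: Lq table qscale_mult[symmetric])
      have Lr: "L (of_real r * p) u = u \<cdot>\<^sub>q (of_real r * p)" if "L p u = u \<cdot>\<^sub>q p" for r p
        using that by (simp add: mult[symmetric] real Lq qscale_mult)
      have q: "q = of_real (qre q) + of_real (qi q) * i + of_real (qj q) * j + of_real (qk q) * k"
        by (simp add: ijk quat_eq_iff quat_mult_sel)
      show ?thesis
        by (subst (1 2) q) (simp add: add qscale_add_right real Lr u k)
    qed
    then show ?thesis by (simp add: F_def)
  qed
  \<comment> \<open>Centrality of the reals keeps \<open>F\<close> stable under real scaling, so a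
    vector can be normalised within \<open>F\<close>.\<close>
  have F_real: "r *\<^sub>R u \<in> F" if "u \<in> F" for r u
  proof -
    have "of_real r * q = q * of_real r" for q :: quat by (simp add: of_real_def)
    with that show ?thesis by (simp add: F_def scaleR_qscale Lq qscale_mult[symmetric])
  qed
  \<comment> \<open>This is the sum of \<open>L e v \<cdot>\<^sub>q qcnj e\<close> over
    \<open>e = 1, i, j, k\<close>, hence four times the average over the quaternion group, as
    \<open>e\<close> and \<open>- e\<close> contribute equally.\<close>
  define P where "P v = v - L i v \<cdot>\<^sub>q i - L j v \<cdot>\<^sub>q j - L k v \<cdot>\<^sub>q k" for v
  note expand = P_def Ldiff Lq qscale_diff_left mult table Lneg L1 qscale_minus_left
    qscale_minus_right qscale_mult[symmetric] qscale_one
  \<comment> \<open>Left multiplication by \<open>i\<close> or \<open>j\<close> permutes the units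
    up to sign, so applying \<open>L\<close> of that unit to \<open>P v\<close> has the effect of
    right scaling by it.\<close>
  have PF: "P v \<in> F" for v
    by (rule FI) (simp_all add: expand)
  \<comment> \<open>For \<open>q\<close>, \<open>e\<close> among \<open>i\<close>, \<open>j\<close>,
    \<open>k\<close>, the product \<open>q * e * q\<close> is \<open>- e\<close> if
    \<open>q = e\<close> and \<open>e\<close> otherwise. Each \<open>L e v \<cdot>\<^sub>q e\<close>
    thus occurs twice with each sign and cancels, while \<open>v\<close> occurs four times.\<close>
  have recover: "P v - P (v \<cdot>\<^sub>q i) \<cdot>\<^sub>q i - P (v \<cdot>\<^sub>q j) \<cdot>\<^sub>q j - P (v \<cdot>\<^sub>q k) \<cdot>\<^sub>q k = 4 *\<^sub>R v" for v
  proof -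
    have P: "P (v \<cdot>\<^sub>q q) \<cdot>\<^sub>q q = v \<cdot>\<^sub>q (q * q) - L i v \<cdot>\<^sub>q (q * i * q) - L j v \<cdot>\<^sub>q (q * j * q)
        - L k v \<cdot>\<^sub>q (q * k * q)" for q
      by (simp add: P_def Lq qscale_diff_left qscale_mult)
    have Pq: "P (v \<cdot>\<^sub>q i) \<cdot>\<^sub>q i = - v + L i v \<cdot>\<^sub>q i - L j v \<cdot>\<^sub>q j - L k v \<cdot>\<^sub>q k"
      "P (v \<cdot>\<^sub>q j) \<cdot>\<^sub>q j = - v - L i v \<cdot>\<^sub>q i + L j v \<cdot>\<^sub>q j - L k v \<cdot>\<^sub>q k"
      "P (v \<cdot>\<^sub>q k) \<cdot>\<^sub>q k = - v - L i v \<cdot>\<^sub>q i - L j v \<cdot>\<^sub>q j + L k v \<cdot>\<^sub>q k"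
      by (simp_all add: P table qscale_minus_right qscale_one)
    have "4 *\<^sub>R v = (v + v) + (v + v)"
      using scaleR_add_left[of 2 2 v] by (simp only: scaleR_2) simp
    then show ?thesis
      by (simp only: Pq) (simp add: P_def)
  qed
  define \<A> where "\<A> = {N. N \<subseteq> F \<and> (\<forall>z\<in>N. norm z = 1) \<and>
    (\<forall>z\<in>N. \<forall>w\<in>N. z \<noteq> w \<longrightarrow> qinner z w = 0)}"
  have "\<exists>N\<in>\<A>. \<forall>X\<in>\<A>. N \<subseteq> X \<longrightarrow> X = N"
  proof (rule subset_Zorn')
    fix C assume C: "subset.chain \<A> C"
    have "qinner z w = 0" if "z \<in> \<Union>C" "w \<in> \<Union>C" "z \<noteq> w" for z w
    proof -
      from that obtain X Y where "z \<in> X" "X \<in> C" "w \<in> Y" "Y \<in> C" by blast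
      then obtain Z where "Z \<in> C" "z \<in> Z" "w \<in> Z"
        using C unfolding subset_chain_def by blast
      then show ?thesis using C that(3) by (auto simp: subset_chain_def \<A>_def)
    qed
    moreover have "X \<subseteq> F" "\<forall>z\<in>X. norm z = 1" if "X \<in> C" for X
      using C that by (auto simp: subset_chain_def \<A>_def)
    ultimately show "\<Union>C \<in> \<A>"
      by (simp add: \<A>_def Sup_le_iff)
  qed
  then obtain N where N: "N \<in> \<A>" and max: "\<And>X. X \<in> \<A> \<Longrightarrow> N \<subseteq> X \<Longrightarrow> X = N" by blast
  have NF: "L q z = z \<cdot>\<^sub>q q" if "z \<in> N" for z q
    using N that by (auto simp: \<A>_def F_def)
  \<comment> \<open>Otherwise the normalised \<open>w\<close> could be adjoined to \<open>N\<close>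
    inside \<open>F\<close>, against maximality.\<close>
  have none: "w = 0" if w: "w \<in> F" "\<And>z. z \<in> N \<Longrightarrow> qinner z w = 0" for w
  proof (rule ccontr)
    assume "w \<noteq> 0"
    define e where "e = (1 / norm w) *\<^sub>R w"
    have e: "norm e = 1" "e \<in> F" using \<open>w \<noteq> 0\<close> w(1) by (auto simp: e_def F_real)
    have eN: "qinner z e = 0" "qinner e z = 0" if "z \<in> N" for z
      using w(2)[OF that] qinner_eq_0_commute[of e z]
      by (simp_all add: e_def scaleR_qscale qinner_qscale_right)
    have "insert e N \<in> \<A>" using N e eN by (auto simp: \<A>_def)
    then have "e \<in> N" using max[of "insert e N"] by blast
    with eN(1) qinner_unit[OF e(1)] show False by simp
  qed
  have "v = 0" if v: "\<And>z. z \<in> N \<Longrightarrow> qinner z v = 0" for v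
  proof -
    \<comment> \<open>For \<open>z\<close> in \<open>N\<close> the adjoint moves \<open>L p\<close>
      onto \<open>z\<close>, where it is right scaling by \<open>qcnj p\<close>. Every summand of
      \<open>P (v \<cdot>\<^sub>q q)\<close> is therefore orthogonal to \<open>z\<close>, and
      \<open>none\<close> applies. All \<open>q\<close> are treated because \<open>recover\<close>
      uses \<open>v\<close> and its multiples by \<open>i\<close>, \<open>j\<close>,
      \<open>k\<close>.\<close>
    have P0: "P (v \<cdot>\<^sub>q q) = 0" for q
    proof (rule none[OF PF])
      fix z assume z: "z \<in> N"
      have "qinner z (L p (v \<cdot>\<^sub>q q)) = 0" for p
        by (simp add: qadj[symmetric] NF z qinner_qscale_left qinner_qscale_right v)
      then show "qinner z (P (v \<cdot>\<^sub>q q)) = 0"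
        by (simp add: P_def qinner_diff_right qinner_qscale_right v z)
    qed
    show ?thesis using recover[of v] P0 P0[of 1] by (simp add: qscale_one)
  qed
  then have basis: "hilbert_basis N"
    using N by (auto simp: hilbert_basis_def \<A>_def)
  \<comment> \<open>Apply the bounded right linear \<open>L q\<close> to the expansion of
    \<open>u\<close>; on \<open>N\<close> it acts as right scaling by \<open>q\<close>.\<close>
  have "((\<lambda>z. z \<cdot>\<^sub>q q \<cdot>\<^sub>q qinner z u) has_sum L q u) N" for q u
    using has_sum_bounded_linear[OF bl[of q] hilbert_basis_expansion[OF basis, of u]]
    by (simp add: Lq NF cong: has_sum_cong)
  with basis show ?thesis unfolding left_scalar_multiplication_def by blast
qed

theorem theoremC:
  fixes L :: "quat \<Rightarrow> 'a::quat_hilbert_space \<Rightarrow> 'a"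
  assumes "\<And>q. L q \<in> qbounded_ops"
  shows "left_scalar_multiplication L \<longleftrightarrow> real_star_algebra_hom L"
  using left_scalar_multiplication_imp_hom[of L, OF assms]
    hom_imp_left_scalar_multiplication[of L, OF assms]
  by blast

end
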